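(* Let $(E,\mathcal{B})$ be a Lusin measurable space, let $\mathcal{U}=(U_\alpha)_{\alpha>0}$ be the resolvent of a right (Markov) process with values in $E$, and let $m$ be a $\sigma$-finite measure on $(E,\mathcal{B})$ that is sub-invariant with respect to $\mathcal{U}$. The following assertions are equivalent. (i) $\mathcal{U}$ is $m$-transient. (ii) There exists a Borel set $A\in\mathcal{B}$ such that $E\setminus A$ is $m$-inessential and the ($1$-order) trivial modification $\mathcal{U}^A$ of $\mathcal{U}$ on $A$ is transient.
   Context: $\mathcal{U}=(U_\alpha)_{\alpha>0}$ is the resolvent of a right Markov process with values in $E$, regarded as a sub-Markovian resolvent of kernels on $(E,\mathcal{B})$ ($\alpha U_\alpha 1\le 1$ and the resolvent equation holds). $p\mathcal{B}$ denotes the positive $\mathcal{B}$-measurable functions on $E$. The initial kernel is $U:=\sup_{\alpha}U_\alpha=\sup_n U_{1/n}$ (and similarly for any other resolvent). A measure $m$ is sub-invariant if $m\circ\alpha U_\alpha\le m$ for all $\alpha>0$. A function $v\in p\mathcal{B}$ is excessive if $\alpha U_\alpha v\le v$ for all $\alpha>0$ and $\alpha U_\alpha v\nearrow v$ as $\alpha\to\infty$. A set $A\in\mathcal{B}$ is absorbing if $A=[v=0]$ for some excessive $v\in p\mathcal{B}$ (equivalently, $1_{E\setminus A}$ is excessive). A set $B\in\mathcal{B}$ is $m$-inessential if $m(B)=0$ and $E\setminus B$ is absorbing. $\mathcal{U}$ is $m$-transient if there is $f\in p\mathcal{B}\cap L^1(E,m)$ such that $m$-a.e. $f>0$ and $Uf<\infty$.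 A resolvent is transient if there is a strictly positive Borel function $f$ on the state space whose image under its initial kernel is finite everywhere. If $E\setminus A$ is $m$-inessential, the $1$-order trivial modification of $\mathcal{U}$ on $A$ is the sub-Markovian resolvent $\mathcal{U}^A=(U^A_\alpha)_{\alpha>0}$ on $(E,\mathcal{B})$ given by $U^A_\alpha f=1_A U_\alpha(f1_A)+\frac{1}{1+\alpha}f1_{E\setminus A}$, $f\in p\mathcal{B}$. *)

theory Defs
  imports "HOL-Probability.Probability"
begin

section \<open>Lusin spaces\<close>

text \<open>
  Up to homeomorphism, the compact metrizable spaces are exactly the compact subsets of the
  countable product of real lines, which is the space \<open>nat \<Rightarrow> real\<close> below with its product topology.
\<close>

definition lusin_measurable_space :: "'a measure \<Rightarrow> bool" where
  "lusin_measurable_space M \<longleftrightarrow>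
    (\<exists>(K :: (nat \<Rightarrow> real) set) S f g.
      compact K \<and> S \<in> sets borel \<and> S \<subseteq> K \<and>
      f \<in> M \<rightarrow>\<^sub>M restrict_space borel S \<and> g \<in> restrict_space borel S \<rightarrow>\<^sub>M M \<and>
      (\<forall>x\<in>space M. g (f x) = x) \<and> (\<forall>y\<in>S. f (g y) = y))"

definition lusin_topology :: "'a topology \<Rightarrow> bool" where
  "lusin_topology T \<longleftrightarrow>
    (\<exists>(K :: (nat \<Rightarrow> real) set) S.
      compact K \<and> S \<in> sets borel \<and> S \<subseteq> K \<and> T homeomorphic_space top_of_set S)"

section \<open>Kernels and resolvents\<close>

text \<open>
  A kernel is represented by its action on positive measurable functions, with values in
  \<open>[0, \<infinity>]\<close>. Its values at non-measurable functions and outside \<open>space M\<close> are irrelevant.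
\<close>

type_synonym 'a operator = "('a \<Rightarrow> ennreal) \<Rightarrow> 'a \<Rightarrow> ennreal"

definition is_kernel :: "'a measure \<Rightarrow> 'a operator \<Rightarrow> bool" where
  "is_kernel M K \<longleftrightarrow>
    (\<exists>N :: 'a \<Rightarrow> 'a measure.
      (\<forall>x\<in>space M. sets (N x) = sets M) \<and>
      (\<forall>A\<in>sets M. (\<lambda>x. emeasure (N x) A) \<in> borel_measurable M) \<and>
      (\<forall>f\<in>borel_measurable M. \<forall>x\<in>space M. K f x = (\<integral>\<^sup>+ y. f y \<partial>N x)))"

text \<open>
  The resolvent equation \<open>U a f - U b f = (b - a) U a (U b f)\<close>, required for all \<open>a, b > 0\<close>, is
  written without subtraction; exchanging the roles of \<open>a\<close> and \<open>b\<close> gives the two equations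
  below for \<open>a \<le> b\<close>.
\<close>

definition sub_markovian_resolvent :: "'a measure \<Rightarrow> (real \<Rightarrow> 'a operator) \<Rightarrow> bool" where
  "sub_markovian_resolvent M U \<longleftrightarrow>
    (\<forall>a>0. is_kernel M (U a)) \<and>
    (\<forall>a>0. \<forall>x\<in>space M. ennreal a * U a (\<lambda>_. 1) x \<le> 1) \<and>
    (\<forall>a>0. \<forall>b\<ge>a. \<forall>f\<in>borel_measurable M. \<forall>x\<in>space M.
      U a f x = U b f x + ennreal (b - a) * U a (U b f) x \<and>
      U a f x = U b f x + ennreal (b - a) * U b (U a f) x)"

definition initial_kernel :: "(real \<Rightarrow> 'a operator) \<Rightarrow> 'a operator" where
  "initial_kernel U f x = (SUP a\<in>{0<..}. U a f x)"

definition sub_invariant :: "(real \<Rightarrow> 'a operator) \<Rightarrow> 'a measure \<Rightarrow> bool" where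
  "sub_invariant U m \<longleftrightarrow>
    (\<forall>a>0. \<forall>A\<in>sets m. (\<integral>\<^sup>+ x. ennreal a * U a (indicator A) x \<partial>m) \<le> emeasure m A)"

definition excessive :: "'a measure \<Rightarrow> (real \<Rightarrow> 'a operator) \<Rightarrow> ('a \<Rightarrow> ennreal) \<Rightarrow> bool" where
  "excessive M U v \<longleftrightarrow>
    v \<in> borel_measurable M \<and>
    (\<forall>x\<in>space M.
      (\<forall>a>0. ennreal a * U a v x \<le> v x) \<and>
      mono_on {0<..} (\<lambda>a. ennreal a * U a v x) \<and>
      ((\<lambda>a. ennreal a * U a v x) \<longlongrightarrow> v x) at_top)"

definition absorbing :: "'a measure \<Rightarrow> (real \<Rightarrow> 'a operator) \<Rightarrow> 'a set \<Rightarrow> bool" where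
  "absorbing M U A \<longleftrightarrow> A \<in> sets M \<and> (\<exists>v. excessive M U v \<and> A = {x \<in> space M. v x = 0})"

definition inessential :: "'a measure \<Rightarrow> (real \<Rightarrow> 'a operator) \<Rightarrow> 'a measure \<Rightarrow> 'a set \<Rightarrow> bool" where
  "inessential M U m B \<longleftrightarrow>
    B \<in> sets M \<and> emeasure m B = 0 \<and> absorbing M U (space M - B)"

definition m_transient :: "'a measure \<Rightarrow> (real \<Rightarrow> 'a operator) \<Rightarrow> 'a measure \<Rightarrow> bool" where
  "m_transient M U m \<longleftrightarrow>
    (\<exists>f\<in>borel_measurable M. (\<integral>\<^sup>+ x. f x \<partial>m) < \<infinity> \<and>
      (AE x in m. 0 < f x \<and> initial_kernel U f x < \<infinity>))"

definition transient :: "'a measure \<Rightarrow> (real \<Rightarrow> 'a operator) \<Rightarrow> bool" where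
  "transient M U \<longleftrightarrow>
    (\<exists>f\<in>borel_measurable M. \<forall>x\<in>space M. 0 < f x \<and> initial_kernel U f x < \<infinity>)"

definition trivial_modification ::
    "'a measure \<Rightarrow> 'a set \<Rightarrow> (real \<Rightarrow> 'a operator) \<Rightarrow> real \<Rightarrow> 'a operator" where
  "trivial_modification M A U a f x =
    indicator A x * U a (\<lambda>y. f y * indicator A y) x
      + ennreal (1 / (1 + a)) * f x * indicator (space M - A) x"

section \<open>Right processes\<close>

text \<open>
  The cemetery is \<open>None :: 'a option\<close>, adjoined to the state space as an isolated point.
  Functions on the state space are extended by \<open>0\<close> to the cemetery.
\<close>

definition cemetery_space :: "'a measure \<Rightarrow> 'a option measure" where
  "cemetery_space M =
    sigma (insert None (Some ` space M)) (insert {None} ((`) Some ` sets M))"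

definition cemetery_topology :: "'a topology \<Rightarrow> 'a option topology" where
  "cemetery_topology T =
    topology (\<lambda>W. W \<subseteq> insert None (Some ` topspace T) \<and> openin T (Some -` W))"

lemma openin_cemetery_topology:
  "openin (cemetery_topology T) W \<longleftrightarrow>
    W \<subseteq> insert None (Some ` topspace T) \<and> openin T (Some -` W)"
proof -
  have "istopology (\<lambda>W. W \<subseteq> insert None (Some ` topspace T) \<and> openin T (Some -` W))"
    unfolding istopology_def by (auto simp: vimage_Int vimage_Union)
  then show ?thesis
    by (simp add: cemetery_topology_def topology_inverse')
qed

definition ext0 :: "('a \<Rightarrow> ennreal) \<Rightarrow> 'a option \<Rightarrow> ennreal" where
  "ext0 f z = (case z of None \<Rightarrow> 0 | Some y \<Rightarrow> f y)"

definition process_semigroup ::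
    "(real \<Rightarrow> 'w \<Rightarrow> 'a option) \<Rightarrow> ('a \<Rightarrow> 'w measure) \<Rightarrow> real \<Rightarrow> 'a operator" where
  "process_semigroup X P t f x = (\<integral>\<^sup>+ \<omega>. ext0 f (X t \<omega>) \<partial>P x)"

definition process_resolvent ::
    "(real \<Rightarrow> 'w \<Rightarrow> 'a option) \<Rightarrow> ('a \<Rightarrow> 'w measure) \<Rightarrow> real \<Rightarrow> 'a operator" where
  "process_resolvent X P a f x =
    (\<integral>\<^sup>+ t\<in>{0..}. (ennreal (exp (- a * t)) * process_semigroup X P t f x) \<partial>lborel)"

definition initial_law :: "'a measure \<Rightarrow> 'a measure \<Rightarrow> bool" where
  "initial_law M \<mu> \<longleftrightarrow> prob_space \<mu> \<and> sets \<mu> = sets M"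

text \<open>
  \<open>null_event W P \<mu> N\<close> says that \<open>N\<close> is null for the law \<open>\<integral> P x \<mu>(dx)\<close> of the process with
  initial law \<open>\<mu>\<close>. Completion is needed because \<open>x \<mapsto> P x N\<close> is only universally measurable.
\<close>

definition null_event :: "'w measure \<Rightarrow> ('a \<Rightarrow> 'w measure) \<Rightarrow> 'a measure \<Rightarrow> 'w set \<Rightarrow> bool" where
  "null_event W P \<mu> N \<longleftrightarrow>
    N \<in> sets W \<and> (\<integral>\<^sup>+ x. emeasure (P x) N \<partial>completion \<mu>) = 0"

definition almost_surely ::
    "'w measure \<Rightarrow> ('a \<Rightarrow> 'w measure) \<Rightarrow> 'a measure \<Rightarrow> ('w \<Rightarrow> bool) \<Rightarrow> bool" where
  "almost_surely W P \<mu> Q \<longleftrightarrow> (\<exists>N. null_event W P \<mu> N \<and> (\<forall>\<omega>\<in>space W - N. Q \<omega>))"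

text \<open>
  \<open>M\<close> is the state space, \<open>W\<close> the underlying measurable space (its measure plays no role),
  \<open>F\<close> the filtration, \<open>\<theta>\<close> the shifts and \<open>P x\<close> the law of the process started at \<open>x\<close>.
  Only times \<open>t \<ge> 0\<close> matter.
\<close>

locale normal_markov_process =
  fixes M :: "'a measure"
    and W :: "'w measure"
    and F :: "real \<Rightarrow> 'w measure"
    and X :: "real \<Rightarrow> 'w \<Rightarrow> 'a option"
    and \<theta> :: "real \<Rightarrow> 'w \<Rightarrow> 'w"
    and P :: "'a \<Rightarrow> 'w measure"
  assumes subalgebra_F: "t \<ge> 0 \<Longrightarrow> subalgebra W (F t)"
    and F_mono: "\<lbrakk>0 \<le> s; s \<le> t\<rbrakk> \<Longrightarrow> sets (F s) \<subseteq> sets (F t)"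
    and adapted: "t \<ge> 0 \<Longrightarrow> X t \<in> F t \<rightarrow>\<^sub>M cemetery_space M"
    and dead: "\<lbrakk>\<omega> \<in> space W; 0 \<le> s; s \<le> t; X s \<omega> = None\<rbrakk> \<Longrightarrow> X t \<omega> = None"
    and shift_space: "\<lbrakk>t \<ge> 0; \<omega> \<in> space W\<rbrakk> \<Longrightarrow> \<theta> t \<omega> \<in> space W"
    and shift: "\<lbrakk>s \<ge> 0; t \<ge> 0; \<omega> \<in> space W\<rbrakk> \<Longrightarrow> X s (\<theta> t \<omega>) = X (s + t) \<omega>"
    and prob_P: "x \<in> space M \<Longrightarrow> prob_space (P x)"
    and sets_P: "x \<in> space M \<Longrightarrow> sets (P x) = sets W"
    and universally_measurable_P:
      "\<lbrakk>A \<in> sets W; initial_law M \<mu>\<rbrakk> \<Longrightarrow>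
        (\<lambda>x. emeasure (P x) A) \<in> borel_measurable (completion \<mu>)"
    and normal: "x \<in> space M \<Longrightarrow> AE \<omega> in P x. X 0 \<omega> = Some x"
    and markov:
      "\<lbrakk>x \<in> space M; s \<ge> 0; t \<ge> 0; f \<in> borel_measurable M; G \<in> sets (F t)\<rbrakk> \<Longrightarrow>
        (\<integral>\<^sup>+ \<omega>\<in>G. ext0 f (X (s + t) \<omega>) \<partial>P x) =
        (\<integral>\<^sup>+ \<omega>\<in>G. ext0 (process_semigroup X P s f) (X t \<omega>) \<partial>P x)"

text \<open>
  In \<open>F_augmented\<close>, the sets described on the right form the intersection over all initial laws
  \<open>\<mu>\<close> of the sigma-algebras generated by \<open>F t\<close> and the null sets of the law with initial
  distribution \<open>\<mu>\<close>. In \<open>excessive_right_continuous\<close>, the resolvent \<open>b \<mapsto> U (a + b)\<close>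
  is the one whose excessive functions are the \<open>a\<close>-excessive functions of \<open>U\<close>.
\<close>

locale right_process = normal_markov_process +
  assumes F_right_continuous: "t \<ge> 0 \<Longrightarrow> sets (F t) = (\<Inter>s\<in>{t<..}. sets (F s))"
    and F_augmented:
      "t \<ge> 0 \<Longrightarrow> sets (F t) =
        {A. A \<subseteq> space W \<and>
          (\<forall>\<mu>. initial_law M \<mu> \<longrightarrow>
            (\<exists>B\<in>sets (F t). \<exists>N. null_event W P \<mu> N \<and> (A - B) \<union> (B - A) \<subseteq> N))}"
    and paths_right_continuous:
      "\<exists>T. lusin_topology T \<and> topspace T = space M \<and>
        sets M = sigma_sets (topspace T) {V. openin T V} \<and>
        (\<forall>\<mu>. initial_law M \<mu> \<longrightarrow>
          almost_surely W P \<mu>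
            (\<lambda>\<omega>. \<forall>t\<ge>0. limitin (cemetery_topology T) (\<lambda>s. X s \<omega>) (X t \<omega>) (at_right t)))"
    and excessive_right_continuous:
      "\<lbrakk>a > 0; excessive M (\<lambda>b. process_resolvent X P (a + b)) f; initial_law M \<mu>\<rbrakk> \<Longrightarrow>
        almost_surely W P \<mu>
          (\<lambda>\<omega>. \<forall>t\<ge>0. continuous (at_right t) (\<lambda>s. ext0 f (X s \<omega>)))"

text \<open>
  \<open>U\<close> is the resolvent of the process, regarded as a resolvent of kernels on \<open>M\<close>.
\<close>

definition resolvent_of ::
    "'a measure \<Rightarrow> (real \<Rightarrow> 'w \<Rightarrow> 'a option) \<Rightarrow> ('a \<Rightarrow> 'w measure) \<Rightarrow> (real \<Rightarrow> 'a operator) \<Rightarrow> bool"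
where
  "resolvent_of M X P U \<longleftrightarrow>
    sub_markovian_resolvent M U \<and>
    (\<forall>a>0. \<forall>f\<in>borel_measurable M. \<forall>x\<in>space M. U a f x = process_resolvent X P a f x)"

end

theory Submission
  imports Defs
begin

text \<open>
  A function \<open>f > 0\<close> with \<open>U f < \<infinity>\<close> almost everywhere is cut down to the sets \<open>{U f \<le> n}\<close>; by
  the maximum principle each piece has a potential bounded everywhere, and a weighted sum \<open>g\<close> of
  the pieces has \<open>U g \<le> 1\<close> everywhere. The set \<open>N = {g = 0}\<close> is \<open>m\<close>-null, so by sub-invariance
  its potential \<open>U 1\<^sub>N\<close> vanishes \<open>m\<close>-almost everywhere. As \<open>U 1\<^sub>N\<close> is excessive, \<open>A = {U 1\<^sub>N = 0}\<close>
  is absorbing, and on \<open>A\<close> the value of \<open>g\<close> may be changed to \<open>1\<close> on \<open>N\<close> without changing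
  \<open>U g\<close>. Conversely, the kernels \<open>U a x\<close> with \<open>x\<close> in an absorbing set \<open>A\<close> are carried by \<open>A\<close>, so
  a function that is transient for the modification stays so for \<open>U\<close> on \<open>A\<close>.
\<close>

section \<open>Kernels acting on positive measurable functions\<close>

text \<open>The definition of a kernel gives measurability in \<open>x\<close> only for the measures
  of sets. The induction carries it from indicators through sums, multiples and increasing limits to
  every positive function. \<open>K f\<close> and the integral agree on \<open>space M\<close> only,
  hence the repeated use of \<open>cong_meas\<close>.\<close>

lemma kernel_measurable:
  fixes M :: "'a measure"
  assumes K: "is_kernel M K" and f: "f \<in> borel_measurable M"
  shows "K f \<in> borel_measurable M"
proof -
  obtain N where N: "\<And>x. x \<in> space M \<Longrightarrow> sets (N x) = sets M"
    "\<And>A. A \<in> sets M \<Longrightarrow> (\<lambda>x. emeasure (N x) A) \<in> borel_measurable M"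
    "\<And>f x. f \<in> borel_measurable M \<Longrightarrow> x \<in> space M \<Longrightarrow> K f x = (\<integral>\<^sup>+ y. f y \<partial>N x)"
    using K unfolding is_kernel_def by blast
  have space_N: "x \<in> space M \<Longrightarrow> space (N x) = space M" for x
    using N(1) sets_eq_imp_space_eq by blast
  have meas: "x \<in> space M \<Longrightarrow> g \<in> borel_measurable M \<Longrightarrow> g \<in> borel_measurable (N x)"
    for x and g :: "'a \<Rightarrow> ennreal"
    using N(1) measurable_cong_sets by blast
  have cong_meas: "F \<in> borel_measurable M"
    if "\<And>x. x \<in> space M \<Longrightarrow> F x = G x" "G \<in> borel_measurable M" for F G :: "'a \<Rightarrow> ennreal"
    using that measurable_cong by blast
  have "(\<lambda>x. \<integral>\<^sup>+ y. f y \<partial>N x) \<in> borel_measurable M"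
    using f
  proof (induction rule: borel_measurable_induct)
    case (cong f g)
    have "(\<integral>\<^sup>+ y. f y \<partial>N x) = (\<integral>\<^sup>+ y. g y \<partial>N x)" if "x \<in> space M" for x
      using cong.hyps space_N[OF that] by (intro nn_integral_cong) simp
    then show ?case
      using cong.IH by (rule cong_meas)
  next
    case (set A)
    have "(\<integral>\<^sup>+ y. indicator A y \<partial>N x) = emeasure (N x) A" if "x \<in> space M" for x
      using set N(1)[OF that] by simp
    then show ?case
      using N(2)[OF set] by (rule cong_meas)
  next
    case (mult u c)
    have "(\<integral>\<^sup>+ y. c * u y \<partial>N x) = c * (\<integral>\<^sup>+ y. u y \<partial>N x)" if "x \<in> space M" for x
      by (rule nn_integral_cmult) (rule meas[OF that mult.hyps(2)])
    moreover have "(\<lambda>x. c * (\<integral>\<^sup>+ y. u y \<partial>N x)) \<in> borel_measurable M"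
      using mult.IH by measurable
    ultimately show ?case
      by (rule cong_meas)
  next
    case (add u v)
    have "(\<integral>\<^sup>+ y. v y + u y \<partial>N x) = (\<integral>\<^sup>+ y. v y \<partial>N x) + (\<integral>\<^sup>+ y. u y \<partial>N x)"
      if "x \<in> space M" for x
      by (rule nn_integral_add) (intro meas[OF that] add.hyps)+
    moreover have "(\<lambda>x. (\<integral>\<^sup>+ y. v y \<partial>N x) + (\<integral>\<^sup>+ y. u y \<partial>N x)) \<in> borel_measurable M"
      using add.IH by measurable
    ultimately show ?case
      by (rule cong_meas)
  next
    case (seq V)
    have "(\<integral>\<^sup>+ y. (SUP i. V i) y \<partial>N x) = (SUP i. \<integral>\<^sup>+ y. V i y \<partial>N x)" if "x \<in> space M" for x
      unfolding SUP_apply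
      by (rule nn_integral_monotone_convergence_SUP[OF seq.hyps(3) meas[OF that seq.hyps(1)]])
    moreover have "(\<lambda>x. SUP i. \<integral>\<^sup>+ y. V i y \<partial>N x) \<in> borel_measurable M"
      using seq.IH by measurable
    ultimately show ?case
      by (rule cong_meas)
  qed
  then show ?thesis
    by (rule cong_meas[rotated]) (rule N(3)[OF f])
qed

text \<open>Freezes the point \<open>x\<close>, so that \<open>f \<mapsto> K f x\<close> becomes
  integration against one measure. The kernel rules that follow are then the corresponding rules for
  this integral.\<close>

lemma kernel_measure:
  fixes M :: "'a measure"
  assumes "is_kernel M K" "x \<in> space M"
  obtains \<nu> where "sets \<nu> = sets M" "space \<nu> = space M"
    "\<And>f :: 'a \<Rightarrow> ennreal. f \<in> borel_measurable M \<Longrightarrow> f \<in> borel_measurable \<nu>"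
    "\<And>f. f \<in> borel_measurable M \<Longrightarrow> K f x = (\<integral>\<^sup>+ y. f y \<partial>\<nu>)"
proof -
  obtain \<nu> where \<nu>: "sets \<nu> = sets M"
    "\<And>f. f \<in> borel_measurable M \<Longrightarrow> K f x = (\<integral>\<^sup>+ y. f y \<partial>\<nu>)"
    using assms unfolding is_kernel_def by blast
  show thesis
  proof (rule that)
    show "f \<in> borel_measurable \<nu>" if "f \<in> borel_measurable M" for f :: "'a \<Rightarrow> ennreal"
      using that measurable_cong_sets[OF \<nu>(1) refl] by blast
  qed (fact \<nu> sets_eq_imp_space_eq[OF \<nu>(1)])+
qed

lemma kernel_mono:
  fixes M :: "'a measure"
  assumes K: "is_kernel M K" and x: "x \<in> space M"
    and f: "f \<in> borel_measurable M" and g: "g \<in> borel_measurable M"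
    and le: "\<And>y. y \<in> space M \<Longrightarrow> f y \<le> g y"
  shows "K f x \<le> K g x"
proof (rule kernel_measure[OF K x])
  fix \<nu> assume \<nu>: "space \<nu> = space M"
    "\<And>f. f \<in> borel_measurable M \<Longrightarrow> K f x = (\<integral>\<^sup>+ y. f y \<partial>\<nu>)"
  show ?thesis
    unfolding \<nu>(2)[OF f] \<nu>(2)[OF g] by (rule nn_integral_mono) (rule le, simp only: \<nu>(1))
qed

lemma kernel_add:
  fixes M :: "'a measure"
  assumes K: "is_kernel M K" and x: "x \<in> space M"
    and f: "f \<in> borel_measurable M" and g: "g \<in> borel_measurable M"
  shows "K (\<lambda>y. f y + g y) x = K f x + K g x"
proof (rule kernel_measure[OF K x])
  fix \<nu> assume \<nu>: "\<And>f :: 'a \<Rightarrow> ennreal. f \<in> borel_measurable M \<Longrightarrow> f \<in> borel_measurable \<nu>"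
    "\<And>f. f \<in> borel_measurable M \<Longrightarrow> K f x = (\<integral>\<^sup>+ y. f y \<partial>\<nu>)"
  have "(\<lambda>y. f y + g y) \<in> borel_measurable M"
    using f g by measurable
  from \<nu>(2)[OF this] show ?thesis
    unfolding \<nu>(2)[OF f] \<nu>(2)[OF g] nn_integral_add[OF \<nu>(1)[OF f] \<nu>(1)[OF g]] .
qed

lemma kernel_cmult:
  fixes M :: "'a measure"
  assumes K: "is_kernel M K" and x: "x \<in> space M" and f: "f \<in> borel_measurable M"
  shows "K (\<lambda>y. c * f y) x = c * K f x"
proof (rule kernel_measure[OF K x])
  fix \<nu> assume \<nu>: "\<And>f :: 'a \<Rightarrow> ennreal. f \<in> borel_measurable M \<Longrightarrow> f \<in> borel_measurable \<nu>"
    "\<And>f. f \<in> borel_measurable M \<Longrightarrow> K f x = (\<integral>\<^sup>+ y. f y \<partial>\<nu>)"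
  have "(\<lambda>y. c * f y) \<in> borel_measurable M"
    using f by measurable
  from \<nu>(2)[OF this] show ?thesis
    unfolding \<nu>(2)[OF f] nn_integral_cmult[OF \<nu>(1)[OF f]] .
qed

lemma kernel_SUP:
  fixes M :: "'a measure" and f :: "nat \<Rightarrow> 'a \<Rightarrow> ennreal"
  assumes K: "is_kernel M K" and x: "x \<in> space M" and f: "\<And>n. f n \<in> borel_measurable M"
    and mono: "\<And>n y. y \<in> space M \<Longrightarrow> f n y \<le> f (Suc n) y"
  shows "K (\<lambda>y. SUP n. f n y) x = (SUP n. K (f n) x)"
proof (rule kernel_measure[OF K x])
  fix \<nu> assume \<nu>: "space \<nu> = space M"
    "\<And>f :: 'a \<Rightarrow> ennreal. f \<in> borel_measurable M \<Longrightarrow> f \<in> borel_measurable \<nu>"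
    "\<And>f. f \<in> borel_measurable M \<Longrightarrow> K f x = (\<integral>\<^sup>+ y. f y \<partial>\<nu>)"
  have "(\<lambda>y. SUP n. f n y) \<in> borel_measurable M"
    using f by measurable
  from \<nu>(3)[OF this] have "K (\<lambda>y. SUP n. f n y) x = (\<integral>\<^sup>+ y. (SUP n. f n y) \<partial>\<nu>)" .
  also have "\<dots> = (SUP n. \<integral>\<^sup>+ y. f n y \<partial>\<nu>)"
  \<comment> \<open>The functions are known to increase on \<open>space M\<close> only, so the
    almost-everywhere form of monotone convergence is the one that fits.\<close>
  proof (rule nn_integral_monotone_convergence_SUP_AE)
    show "AE y in \<nu>. f n y \<le> f (Suc n) y" for n
      by (rule AE_I2) (rule mono, simp only: \<nu>(1))
  qed (rule \<nu>(2)[OF f])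
  finally show ?thesis
    unfolding \<nu>(3)[OF f] .
qed

lemma kernel_suminf:
  fixes M :: "'a measure" and f :: "nat \<Rightarrow> 'a \<Rightarrow> ennreal"
  assumes K: "is_kernel M K" and x: "x \<in> space M" and f: "\<And>n. f n \<in> borel_measurable M"
  shows "K (\<lambda>y. \<Sum>n. f n y) x = (\<Sum>n. K (f n) x)"
proof (rule kernel_measure[OF K x])
  fix \<nu> assume \<nu>: "\<And>f :: 'a \<Rightarrow> ennreal. f \<in> borel_measurable M \<Longrightarrow> f \<in> borel_measurable \<nu>"
    "\<And>f. f \<in> borel_measurable M \<Longrightarrow> K f x = (\<integral>\<^sup>+ y. f y \<partial>\<nu>)"
  have "(\<lambda>y. \<Sum>n. f n y) \<in> borel_measurable M"
    using f by measurable
  from \<nu>(2)[OF this] show ?thesis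
    unfolding \<nu>(2)[OF f] nn_integral_suminf[OF \<nu>(1)[OF f]] .
qed

text \<open>A vanishing integral forces \<open>f = 0\<close> almost everywhere for the measure at
  \<open>x\<close>, and \<open>g\<close> vanishes wherever \<open>f\<close> does. With an excessive
  function in the place of \<open>f\<close> this shows that the measure does not charge the
  complement of an absorbing set.\<close>

lemma kernel_eq_0:
  fixes M :: "'a measure"
  assumes K: "is_kernel M K" and x: "x \<in> space M"
    and f: "f \<in> borel_measurable M" and g: "g \<in> borel_measurable M"
    and zero: "\<And>y. y \<in> space M \<Longrightarrow> f y = 0 \<Longrightarrow> g y = 0" and Kf: "K f x = 0"
  shows "K g x = 0"
proof (rule kernel_measure[OF K x])
  fix \<nu> assume \<nu>: "space \<nu> = space M"
    "\<And>f :: 'a \<Rightarrow> ennreal. f \<in> borel_measurable M \<Longrightarrow> f \<in> borel_measurable \<nu>"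
    "\<And>f. f \<in> borel_measurable M \<Longrightarrow> K f x = (\<integral>\<^sup>+ y. f y \<partial>\<nu>)"
  have "AE y in \<nu>. f y = 0"
    using Kf unfolding \<nu>(3)[OF f] nn_integral_0_iff_AE[OF \<nu>(2)[OF f]] .
  then have "AE y in \<nu>. g y = 0"
    using AE_space by eventually_elim (rule zero, simp only: \<nu>(1))
  then show ?thesis
    unfolding \<nu>(3)[OF g] nn_integral_0_iff_AE[OF \<nu>(2)[OF g]] .
qed

section \<open>Sub-Markovian resolvents and the initial kernel\<close>

locale resolvent =
  fixes M :: "'a measure" and U :: "real \<Rightarrow> 'a operator"
  assumes sub_markovian: "sub_markovian_resolvent M U"
begin

lemma kernel: "a > 0 \<Longrightarrow> is_kernel M (U a)"
  using sub_markovian by (simp add: sub_markovian_resolvent_def)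

lemma U_1_le: "a > 0 \<Longrightarrow> x \<in> space M \<Longrightarrow> ennreal a * U a (\<lambda>_. 1) x \<le> 1"
  using sub_markovian by (simp add: sub_markovian_resolvent_def)

lemma resolvent_eq:
  assumes "0 < a" "a \<le> b" "f \<in> borel_measurable M" "x \<in> space M"
  shows "U a f x = U b f x + ennreal (b - a) * U b (U a f) x"
  using sub_markovian assms unfolding sub_markovian_resolvent_def by blast

lemma antimono:
  assumes "0 < a" "a \<le> b" "f \<in> borel_measurable M" "x \<in> space M"
  shows "U b f x \<le> U a f x"
  by (subst resolvent_eq[OF assms]) simp

lemma measurable_U[measurable]:
  "a > 0 \<Longrightarrow> f \<in> borel_measurable M \<Longrightarrow> U a f \<in> borel_measurable M"
  by (rule kernel_measurable[OF kernel])

text \<open>The kernel \<open>a U a\<close> has total mass at most \<open>1\<close>, so it preserves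
  upper bounds by constants.\<close>

lemma mult_U_le:
  assumes a: "a > 0" and x: "x \<in> space M" and f: "f \<in> borel_measurable M"
    and le: "\<And>y. y \<in> space M \<Longrightarrow> f y \<le> c"
  shows "ennreal a * U a f x \<le> c"
proof -
  have "U a f x \<le> U a (\<lambda>_. c * 1) x"
    by (rule kernel_mono[OF kernel[OF a] x f]) (use le in auto)
  also have "\<dots> = c * U a (\<lambda>_. 1) x"
    by (rule kernel_cmult[OF kernel[OF a] x]) simp
  finally have "ennreal a * U a f x \<le> c * (ennreal a * U a (\<lambda>_. 1) x)"
    by (metis mult.left_commute mult_left_mono zero_le)
  also have "\<dots> \<le> c * 1"
    by (intro mult_left_mono U_1_le a x) simp
  finally show ?thesis by simp
qed

lemma U_le_initial: "a > 0 \<Longrightarrow> U a f x \<le> initial_kernel U f x"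
  unfolding initial_kernel_def by (rule SUP_upper) simp

text \<open>\<open>U a f x\<close> grows as \<open>a\<close> decreases, so the supremum is already
  reached along the sequence \<open>1 / Suc n\<close>. This makes measurability, monotone
  convergence and countable unions of null sets available for the initial kernel.\<close>

lemma initial_kernel_SUP_seq:
  assumes "f \<in> borel_measurable M" "x \<in> space M"
  shows "initial_kernel U f x = (SUP n. U (1 / Suc n) f x)"
  unfolding initial_kernel_def
proof (rule antisym)
  show "(SUP a\<in>{0<..}. U a f x) \<le> (SUP n. U (1 / Suc n) f x)"
  proof (rule SUP_least)
    fix a :: real assume "a \<in> {0<..}"
    then obtain n where "1 / Suc n < a"
      using nat_approx_posE by auto
    then have "U a f x \<le> U (1 / Suc n) f x"
      using assms by (intro antimono) auto
    then show "U a f x \<le> (SUP n. U (1 / Suc n) f x)"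
      by (meson SUP_upper2 UNIV_I)
  qed
  show "(SUP n. U (1 / Suc n) f x) \<le> (SUP a\<in>{0<..}. U a f x)"
    by (rule SUP_mono) auto
qed

lemma U_seq_Suc:
  assumes "f \<in> borel_measurable M" "x \<in> space M"
  shows "U (1 / Suc n) f x \<le> U (1 / Suc (Suc n)) f x"
  using assms by (intro antimono) (auto simp: field_simps)

lemma measurable_initial_kernel[measurable]:
  assumes [measurable]: "f \<in> borel_measurable M"
  shows "initial_kernel U f \<in> borel_measurable M"
proof -
  have "(\<lambda>x. SUP n. U (1 / Suc n) f x) \<in> borel_measurable M"
    by measurable
  moreover have "initial_kernel U f \<in> borel_measurable M
      \<longleftrightarrow> (\<lambda>x. SUP n. U (1 / Suc n) f x) \<in> borel_measurable M"
    by (rule measurable_cong) (rule initial_kernel_SUP_seq[OF assms])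
  ultimately show ?thesis by simp
qed

lemma initial_kernel_mono:
  assumes "f \<in> borel_measurable M" "g \<in> borel_measurable M" "x \<in> space M"
    and "\<And>y. y \<in> space M \<Longrightarrow> f y \<le> g y"
  shows "initial_kernel U f x \<le> initial_kernel U g x"
  unfolding initial_kernel_def
  using assms by (intro SUP_mono) (auto intro: kernel_mono[OF kernel])

text \<open>This is the limit of the resolvent equation between \<open>1 / Suc n\<close> and
  \<open>b\<close>, with monotone convergence inside \<open>U b\<close>. The additive form stays
  meaningful where the initial kernel is infinite.\<close>

lemma initial_kernel_eq:
  assumes b: "b > 0" and f[measurable]: "f \<in> borel_measurable M" and x: "x \<in> space M"
  shows "initial_kernel U f x = U b f x + ennreal b * U b (initial_kernel U f) x"
proof -
  let ?a = "\<lambda>n. 1 / Suc n"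
  have meas: "U (?a n) f \<in> borel_measurable M" for n
    by (rule measurable_U) auto
  have lim: "(\<lambda>n. U (?a n) f x) \<longlonglongrightarrow> initial_kernel U f x"
    unfolding initial_kernel_SUP_seq[OF f x]
    by (intro LIMSEQ_SUP incseq_SucI U_seq_Suc f x)
  have "U b (\<lambda>y. SUP n. U (?a n) f y) x = (SUP n. U b (U (?a n) f) x)"
    by (rule kernel_SUP[OF kernel[OF b] x meas]) (rule U_seq_Suc[OF f])
  \<comment> \<open>The two arguments of \<open>U b\<close> coincide on \<open>space M\<close> only,
    so monotonicity is applied in both directions instead of rewriting one function into the
    other.\<close>
  moreover have "U b (initial_kernel U f) x = U b (\<lambda>y. SUP n. U (?a n) f y) x"
    by (intro antisym kernel_mono[OF kernel[OF b] x])
       (use meas in \<open>auto simp: initial_kernel_SUP_seq[OF f]\<close>)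
  moreover have "U b (U (?a n) f) x \<le> U b (U (?a (Suc n)) f) x" for n
    by (rule kernel_mono[OF kernel[OF b] x meas meas]) (rule U_seq_Suc[OF f])
  then have "(\<lambda>n. U b (U (?a n) f) x) \<longlonglongrightarrow> (SUP n. U b (U (?a n) f) x)"
    by (intro LIMSEQ_SUP incseq_SucI)
  ultimately have "(\<lambda>n. U b (U (?a n) f) x) \<longlonglongrightarrow> U b (initial_kernel U f) x"
    by argo
  moreover have "(\<lambda>n. ennreal (b - ?a n)) \<longlonglongrightarrow> ennreal b"
  proof (rule tendsto_ennrealI)
    have "(\<lambda>n. b - ?a n) \<longlonglongrightarrow> b - 0"
      using LIMSEQ_inverse_real_of_nat
      by (intro tendsto_diff tendsto_const) (simp add: inverse_eq_divide)
    then show "(\<lambda>n. b - ?a n) \<longlonglongrightarrow> b" by simp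
  qed
  \<comment> \<open>The product passes to the limit because \<open>b\<close> is finite and nonzero,
    which excludes the indeterminate form \<open>0 * \<infinity>\<close>.\<close>
  ultimately have "(\<lambda>n. U b f x + ennreal (b - ?a n) * U b (U (?a n) f) x)
      \<longlonglongrightarrow> U b f x + ennreal b * U b (initial_kernel U f) x"
    using b by (intro tendsto_add tendsto_const tendsto_mult_ennreal) auto
  \<comment> \<open>The resolvent equation is available once \<open>1 / Suc n \<le> b\<close>, that
    is, for all large \<open>n\<close>.\<close>
  moreover have "\<forall>\<^sub>F n in sequentially.
      U b f x + ennreal (b - ?a n) * U b (U (?a n) f) x = U (?a n) f x"
  proof -
    obtain N where "?a N < b"
      using nat_approx_posE[OF b] by auto
    then have "?a n \<le> b" if "n \<ge> N" for n
      using that by (smt (verit) frac_le of_nat_0_less_iff of_nat_mono zero_less_Suc Suc_le_mono)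
    then show ?thesis
      using resolvent_eq[OF _ _ f x, symmetric]
      by (intro eventually_sequentiallyI[of N]) simp
  qed
  ultimately have "(\<lambda>n. U (?a n) f x) \<longlonglongrightarrow> U b f x + ennreal b * U b (initial_kernel U f) x"
    by (rule Lim_transform_eventually)
  then show ?thesis
    using lim LIMSEQ_unique by blast
qed

section \<open>Excessive potentials, the maximum principle and bounded potentials\<close>

text \<open>For bounded \<open>f\<close> the value \<open>U b f x\<close> is at most
  \<open>k / b\<close>, hence finite, and can be subtracted in \<open>initial_kernel_eq\<close> even
  where the potential is infinite. So \<open>b U b\<close> maps the potential to itself minus
  \<open>U b f\<close>, and this last term decreases to \<open>0\<close> as \<open>b\<close>
  grows.\<close>

lemma excessive_initial_kernel:
  assumes f: "f \<in> borel_measurable M" and le: "\<And>y. y \<in> space M \<Longrightarrow> f y \<le> ennreal k"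
  shows "excessive M U (initial_kernel U f)"
  unfolding excessive_def
proof (intro conjI ballI)
  let ?v = "initial_kernel U f"
  show "?v \<in> borel_measurable M"
    by (rule measurable_initial_kernel[OF f])
  fix x assume x: "x \<in> space M"
  have bound: "U b f x \<le> ennreal (k / b)" if "b > 0" for b
  proof -
    have "ennreal (1 / b) * (ennreal b * U b f x) \<le> ennreal (1 / b) * ennreal k"
      by (intro mult_left_mono mult_U_le that x f le) auto
    then show ?thesis
      using that by (simp add: mult.assoc[symmetric] ennreal_mult'[symmetric])
  qed
  have eq: "ennreal b * U b ?v x = ?v x - U b f x" if "b > 0" for b
  proof -
    have "U b f x \<noteq> \<top>"
      using bound[OF that] by (metis ennreal_neq_top top.extremum_unique)
    then show ?thesis
      using initial_kernel_eq[OF that f x] by (metis ennreal_add_diff_cancel_left)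
  qed
  show "\<forall>a>0. ennreal a * U a ?v x \<le> ?v x"
    by (simp add: eq diff_le_self_ennreal)
  show "mono_on {0<..} (\<lambda>a. ennreal a * U a ?v x)"
    by (rule mono_onI) (auto simp: eq intro!: ennreal_mono_minus antimono f x)
  have "((\<lambda>b. U b f x) \<longlongrightarrow> 0) at_top"
  proof (rule tendsto_sandwich[OF _ _ tendsto_const])
    show "\<forall>\<^sub>F b in at_top. U b f x \<le> ennreal (k / b)"
      using eventually_gt_at_top[of 0] by eventually_elim (rule bound)
    show "((\<lambda>b. ennreal (k / b)) \<longlongrightarrow> 0) at_top"
      by (rule tendsto_eq_rhs[OF tendsto_ennrealI[OF tendsto_divide_0[OF tendsto_const]]])
         (auto intro: filterlim_at_top_imp_at_infinity filterlim_ident)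
  qed simp
  then have "((\<lambda>b. ?v x - U b f x) \<longlongrightarrow> ?v x - 0) at_top"
    by (intro tendsto_diff_ennreal_general tendsto_const) auto
  moreover have "\<forall>\<^sub>F b in at_top. ?v x - U b f x = ennreal b * U b ?v x"
    using eventually_gt_at_top[of 0] by eventually_elim (simp add: eq)
  ultimately show "((\<lambda>a. ennreal a * U a ?v x) \<longlongrightarrow> ?v x) at_top"
    by (auto elim: Lim_transform_eventually)
qed

text \<open>
  For \<open>z = h + (b - a) U a h\<close> the resolvent equation reads \<open>z = h + r (b U b) z\<close> with
  \<open>r = 1 - a / b\<close>. Where \<open>h > 0\<close> we have \<open>z \<le> k + b c\<close>, elsewhere \<open>z \<le> r sup z\<close>; as \<open>sup z\<close> is
  finite and \<open>r < 1\<close>, this forces \<open>z \<le> k + b c\<close> everywhere. Divide by \<open>b\<close> and let \<open>b\<close> tend to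
  infinity.
\<close>

lemma maximum_principle:
  assumes h[measurable]: "h \<in> borel_measurable M"
    and le: "\<And>y. y \<in> space M \<Longrightarrow> h y \<le> ennreal k" and k: "k \<ge> 0" and c: "c \<ge> 0"
    and dom: "\<And>y. y \<in> space M \<Longrightarrow> h y > 0 \<Longrightarrow> initial_kernel U h y \<le> ennreal c"
    and x: "x \<in> space M"
  shows "initial_kernel U h x \<le> ennreal c"
  unfolding initial_kernel_def
proof (rule SUP_least)
  fix a :: real assume "a \<in> {0<..}"
  then have a: "a > 0" by simp
  have key: "ennreal (b - a) * U a h x \<le> ennreal (k + b * c)" if b: "b > a" for b
  proof -
    define z where "z = (\<lambda>y. h y + ennreal (b - a) * U a h y)"
    define S where "S = (SUP y\<in>space M. z y)"
    define K where "K = ennreal (k + b * c)"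
    define r where "r = (b - a) / b"
    have b0: "b > 0" using a b by simp
    have r: "0 \<le> r" "r < 1"
      using a b by (auto simp: r_def)
    have z_meas[measurable]: "z \<in> borel_measurable M"
      unfolding z_def using a by measurable
    have zS: "z y \<le> S" if "y \<in> space M" for y
      unfolding S_def using that by (rule SUP_upper)
    \<comment> \<open>The bound, which equals \<open>b k / a\<close>, is crude; it serves only to
      show that the supremum \<open>S\<close> is finite, so that \<open>S \<le> r S\<close> with
      \<open>r < 1\<close> becomes a contradiction for \<open>S > 0\<close>.\<close>
    have "z y \<le> ennreal (k + (b - a) * (k / a))" if y: "y \<in> space M" for y
    proof -
      have "ennreal (1 / a) * (ennreal a * U a h y) \<le> ennreal (1 / a) * ennreal k"
        by (intro mult_left_mono mult_U_le a y h le) auto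
      then have "U a h y \<le> ennreal (k / a)"
        using a by (simp add: mult.assoc[symmetric] ennreal_mult'[symmetric])
      then have "z y \<le> ennreal k + ennreal (b - a) * ennreal (k / a)"
        unfolding z_def by (intro add_mono le y mult_left_mono) auto
      also have "\<dots> = ennreal (k + (b - a) * (k / a))"
        using a b k by (simp add: ennreal_mult'[symmetric] ennreal_plus[symmetric] del: ennreal_plus)
      finally show ?thesis .
    qed
    then have "S \<le> ennreal (k + (b - a) * (k / a))"
      unfolding S_def by (rule SUP_least)
    then have S_fin: "S \<noteq> \<top>"
      by (metis ennreal_neq_top top.extremum_unique)
    have "z y \<le> max K (ennreal r * S)" if y: "y \<in> space M" for y
    proof (cases "h y > 0")
      case True
      have "ennreal (b - a) * U a h y \<le> ennreal b * ennreal c"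
        using a U_le_initial[OF a, of h y] dom[OF y True]
        by (intro mult_mono ennreal_leI) auto
      then have "z y \<le> ennreal k + ennreal b * ennreal c"
        unfolding z_def by (intro add_mono le y)
      also have "\<dots> = K"
        unfolding K_def using b0 k c
        by (simp add: ennreal_mult'[symmetric] ennreal_plus[symmetric] del: ennreal_plus)
      finally show ?thesis by (rule max.coboundedI1)
    next
      case False
      then have "z y = ennreal (b - a) * U a h y"
        by (simp add: z_def)
      also have "U a h y = U b z y"
      proof -
        have "U b z y = U b h y + U b (\<lambda>w. ennreal (b - a) * U a h w) y"
          unfolding z_def by (rule kernel_add[OF kernel[OF b0] y]) (use a in measurable)
        also have "U b (\<lambda>w. ennreal (b - a) * U a h w) y = ennreal (b - a) * U b (U a h) y"
          by (rule kernel_cmult[OF kernel[OF b0] y]) (use a in measurable)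
        finally show ?thesis
          using resolvent_eq[OF a less_imp_le[OF b] h y] by simp
      qed
      also have "ennreal (b - a) = ennreal r * ennreal b"
        using b0 r by (simp add: r_def ennreal_mult'[symmetric])
      also have "ennreal r * ennreal b * U b z y \<le> ennreal r * S"
        unfolding mult.assoc by (intro mult_left_mono mult_U_le[OF b0 y z_meas] zS) auto
      finally show ?thesis by (rule max.coboundedI2)
    qed
    then have S_le: "S \<le> max K (ennreal r * S)"
      unfolding S_def[symmetric] by (subst (1) S_def) (rule SUP_least)
    have "S \<le> K"
    proof (rule ccontr)
      assume "\<not> S \<le> K"
      then have S0: "S > 0" and "S \<le> ennreal r * S"
        using S_le by (auto simp: max_def not_le split: if_splits intro: le_less_trans[of 0 K])
      obtain s where s: "S = ennreal s" "s \<ge> 0"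
        using S_fin by (cases S) auto
      then have "s > 0" "s \<le> r * s"
        using S0 \<open>S \<le> ennreal r * S\<close> r by (auto simp: ennreal_mult'[symmetric])
      then show False
        using r by (simp add: mult_le_cancel_right1)
    qed
    have "ennreal (b - a) * U a h x \<le> z x"
      by (simp add: z_def)
    also have "\<dots> \<le> K"
      using zS[OF x] \<open>S \<le> K\<close> by simp
    finally show ?thesis by (simp add: K_def)
  qed
  have "((\<lambda>b. ennreal ((k + b * c) / (b - a))) \<longlongrightarrow> ennreal c) at_top"
    by (rule tendsto_ennrealI) real_asymp
  moreover have "\<forall>\<^sub>F b in at_top. U a h x \<le> ennreal ((k + b * c) / (b - a))"
    using eventually_gt_at_top[of a]
  proof eventually_elim
    case (elim b)
    have "ennreal (1 / (b - a)) * (ennreal (b - a) * U a h x)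
        \<le> ennreal (1 / (b - a)) * ennreal (k + b * c)"
      by (intro mult_left_mono key elim) simp
    then show ?case
      using elim by (simp add: mult.assoc[symmetric] ennreal_mult'[symmetric])
  qed
  ultimately show "U a h x \<le> ennreal c"
    by (intro tendsto_lowerbound[where F = at_top]) auto
qed

text \<open>Trades strict positivity for a potential bounded at every point: the constructed
  \<open>g\<close> vanishes where \<open>f = 0\<close> or where the potential of \<open>f\<close> is
  infinite. This exceptional set is removed later with the help of sub-invariance.\<close>

lemma bounded_potential:
  assumes f[measurable]: "f \<in> borel_measurable M"
  obtains g where "g \<in> borel_measurable M"
    and "\<And>x. x \<in> space M \<Longrightarrow> initial_kernel U g x \<le> 1"
    and "\<And>x. x \<in> space M \<Longrightarrow> f x > 0 \<Longrightarrow> initial_kernel U f x < \<infinity> \<Longrightarrow> g x > 0"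
proof
  define D where "D n = {x \<in> space M. initial_kernel U f x \<le> ennreal (Suc n)}" for n
  \<comment> \<open>Truncating at \<open>1\<close> gives the boundedness that the maximum principle
    asks for, and keeps \<open>h n\<close> positive wherever \<open>f\<close> is positive on
    \<open>D n\<close>.\<close>
  define h where "h n x = min (f x) 1 * indicator (D n) x" for n x
  \<comment> \<open>The factor \<open>1 / Suc n\<close> brings the potential of \<open>h n\<close>
    below \<open>1\<close>; the weights \<open>(1/2) ^ Suc n\<close> sum to
    \<open>1\<close>.\<close>
  define g where "g x = (\<Sum>n. ennreal ((1/2) ^ Suc n) * (ennreal (1 / Suc n) * h n x))" for x
  have D[measurable]: "D n \<in> sets M" for n
    unfolding D_def by measurable
  have h[measurable]: "h n \<in> borel_measurable M" for n
    unfolding h_def by measurable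
  show "g \<in> borel_measurable M"
    unfolding g_def by measurable
  have Uh: "initial_kernel U (h n) x \<le> ennreal (Suc n)" if x: "x \<in> space M" for n x
  proof (rule maximum_principle[OF h _ _ _ _ x])
    show "h n y \<le> ennreal 1" for y
      by (auto simp: h_def indicator_def)
    fix y assume y: "y \<in> space M" "h n y > 0"
    then have "y \<in> D n"
      by (cases "y \<in> D n") (simp_all add: h_def)
    moreover have "initial_kernel U (h n) y \<le> initial_kernel U f y"
      by (rule initial_kernel_mono[OF h f y(1)]) (auto simp: h_def indicator_def)
    ultimately show "initial_kernel U (h n) y \<le> ennreal (Suc n)"
      by (auto simp: D_def)
  qed auto
  show "initial_kernel U g x \<le> 1" if x: "x \<in> space M" for x
    unfolding initial_kernel_def
  proof (rule SUP_least)
    fix a :: real assume "a \<in> {0<..}"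
    then have a: "a > 0" by simp
    \<comment> \<open>The estimate is made for each \<open>U a\<close>, since countable sums pass
      through a kernel; the supremum over \<open>a\<close> comes last.\<close>
    have "U a g x = (\<Sum>n. U a (\<lambda>x. ennreal ((1/2) ^ Suc n) * (ennreal (1 / Suc n) * h n x)) x)"
      unfolding g_def by (rule kernel_suminf[OF kernel[OF a] x]) measurable
    also have "\<dots> = (\<Sum>n. ennreal ((1/2) ^ Suc n) * (ennreal (1 / Suc n) * U a (h n) x))"
    proof (rule suminf_cong)
      fix n
      show "U a (\<lambda>x. ennreal ((1/2) ^ Suc n) * (ennreal (1 / Suc n) * h n x)) x
          = ennreal ((1/2) ^ Suc n) * (ennreal (1 / Suc n) * U a (h n) x)"
        by (subst kernel_cmult[OF kernel[OF a] x], measurable)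
           (subst kernel_cmult[OF kernel[OF a] x], auto)
    qed
    also have "\<dots> \<le> (\<Sum>n. ennreal ((1/2) ^ Suc n))"
    proof (intro suminf_le summableI)
      fix n
      have "ennreal (1 / Suc n) * U a (h n) x \<le> ennreal (1 / Suc n) * ennreal (Suc n)"
        using U_le_initial[OF a] Uh[OF x] by (intro mult_left_mono) (auto intro: order_trans)
      also have "\<dots> = 1"
        by (subst ennreal_mult'[symmetric]) auto
      finally show "ennreal ((1/2) ^ Suc n) * (ennreal (1 / Suc n) * U a (h n) x) \<le> ennreal ((1/2) ^ Suc n)"
        by (metis mult.right_neutral mult_left_mono zero_le)
    qed
    also have "\<dots> = 1"
      by (subst suminf_ennreal_eq[OF zero_le_power power_half_series]) auto
    finally show "U a g x \<le> 1" .
  qed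
  show "g x > 0" if x: "x \<in> space M" and fx: "f x > 0" and fin: "initial_kernel U f x < \<infinity>" for x
  proof -
    obtain s where s: "initial_kernel U f x = ennreal s"
      using fin by (cases "initial_kernel U f x") auto
    obtain n where "s \<le> real n"
      using real_arch_simple by blast
    then have "ennreal s \<le> ennreal (Suc n)"
      by (intro ennreal_leI) simp
    then have "x \<in> D n"
      using x by (simp add: D_def s del: of_nat_Suc)
    then have "h n x > 0"
      using fx by (simp add: h_def)
    then have "ennreal ((1/2) ^ Suc n) * (ennreal (1 / Suc n) * h n x) > 0"
      by (simp add: ennreal_zero_less_mult_iff del: power_Suc)
    also have "ennreal ((1/2) ^ Suc n) * (ennreal (1 / Suc n) * h n x) \<le> g x"
      unfolding g_def
      using sum_le_suminf[OF summableI, of "{n}" "\<lambda>n. ennreal ((1/2) ^ Suc n) * (ennreal (1 / Suc n) * h n x)"]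
      by simp
    finally show ?thesis .
  qed
qed

section \<open>Trivial modifications and absorbing sets\<close>

lemma initial_kernel_trivial_modification:
  assumes x: "x \<in> A"
  shows "initial_kernel (trivial_modification M A U) f x
    = initial_kernel U (\<lambda>y. f y * indicator A y) x"
  using x by (simp add: initial_kernel_def trivial_modification_def)

text \<open>Off \<open>A\<close> the modified resolvent is multiplication by
  \<open>1 / (1 + a) \<le> 1\<close>. Finiteness of the potential there is thus automatic for a
  finite function.\<close>

lemma initial_kernel_trivial_modification_le:
  assumes x: "x \<notin> A"
  shows "initial_kernel (trivial_modification M A U) f x \<le> f x"
  unfolding initial_kernel_def
proof (rule SUP_least)
  fix a :: real assume "a \<in> {0<..}"
  then have "ennreal (1 / (1 + a)) \<le> ennreal 1"
    by (intro ennreal_leI) auto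
  then have "ennreal (1 / (1 + a)) * f x \<le> f x"
    by (metis ennreal_1 mult_1 mult_right_mono zero_le)
  then show "trivial_modification M A U a f x \<le> f x"
    using x by (auto simp: trivial_modification_def indicator_def)
qed

text \<open>Let \<open>A\<close> be the zero set of an excessive \<open>v\<close>. At
  \<open>x\<close> in \<open>A\<close> the inequality \<open>a U a v x \<le> v x = 0\<close> shows
  that the measure behind \<open>U a\<close> at \<open>x\<close> puts no mass on
  \<open>v > 0\<close>, the complement of \<open>A\<close>, which is where \<open>f\<close> may be
  nonzero.\<close>

lemma absorbing_initial_kernel_eq_0:
  assumes A: "absorbing M U A" and x: "x \<in> A"
    and f: "f \<in> borel_measurable M" "\<And>y. y \<in> A \<Longrightarrow> f y = 0"
  shows "initial_kernel U f x = 0"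
proof -
  obtain v where v: "excessive M U v" "A = {x \<in> space M. v x = 0}"
    using A by (auto simp: absorbing_def)
  have vm: "v \<in> borel_measurable M"
    using v(1) by (simp add: excessive_def)
  have "U a f x = 0" if a: "a > 0" for a
  proof (rule kernel_eq_0[OF kernel[OF a] _ vm f(1)])
    have "ennreal a * U a v x \<le> v x"
      using v x a by (auto simp: excessive_def)
    then show "U a v x = 0"
      using v x a by auto
  qed (use v f x in auto)
  then show ?thesis
    by (simp add: initial_kernel_def)
qed

section \<open>The two implications\<close>

lemma m_transient_imp_transient_modification:
  assumes sets_m: "sets m = sets M" and m: "sub_invariant U m" and trans: "m_transient M U m"
  shows "\<exists>A\<in>sets M. inessential M U m (space M - A) \<and> transient M (trivial_modification M A U)"
proof -
  note [measurable_cong] = sets_m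
  have space_m: "space m = space M"
    using sets_m by (rule sets_eq_imp_space_eq)
  obtain f where f: "f \<in> borel_measurable M"
      "AE x in m. 0 < f x \<and> initial_kernel U f x < \<infinity>"
    using trans by (auto simp: m_transient_def)
  obtain g where g[measurable]: "g \<in> borel_measurable M"
    and Ug: "\<And>x. x \<in> space M \<Longrightarrow> initial_kernel U g x \<le> 1"
    and g_pos: "\<And>x. x \<in> space M \<Longrightarrow> f x > 0 \<Longrightarrow> initial_kernel U f x < \<infinity> \<Longrightarrow> g x > 0"
    using bounded_potential[OF f(1)] by blast
  define N where "N = {x \<in> space M. g x = 0}"
  define A where "A = {x \<in> space M. initial_kernel U (indicator N) x = 0}"
  have N[measurable]: "N \<in> sets M"
    unfolding N_def by measurable
  have A[measurable]: "A \<in> sets M"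
    unfolding A_def by measurable
  have "AE x in m. x \<notin> N"
    using f(2) AE_space
  proof eventually_elim
    case (elim x)
    with g_pos[of x] show ?case
      by (auto simp: N_def space_m)
  qed
  then have N_null: "emeasure m N = 0"
    using N sets_m by (simp add: AE_iff_measurable[where N = N] N_def space_m)
  \<comment> \<open>Sub-invariance at \<open>1 / Suc n\<close> bounds the integral by
    \<open>m(N) = 0\<close>. Restricting to this sequence leaves countably many exceptional null
    sets.\<close>
  have "AE x in m. U (1 / Suc n) (indicator N) x = 0" for n
  proof -
    have pos: "1 / real (Suc n) > 0" by simp
    have "(\<integral>\<^sup>+ x. ennreal (1 / Suc n) * U (1 / Suc n) (indicator N) x \<partial>m) \<le> emeasure m N"
      using m N pos unfolding sub_invariant_def sets_m by blast
    moreover have "(\<lambda>x. ennreal (1 / Suc n) * U (1 / Suc n) (indicator N) x) \<in> borel_measurable m"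
      using measurable_U[OF pos, of "indicator N"] by measurable
    ultimately show ?thesis
      using N_null by (simp add: nn_integral_0_iff_AE)
  qed
  then have "AE x in m. \<forall>n. U (1 / Suc n) (indicator N) x = 0"
    by (simp add: AE_all_countable)
  then have "AE x in m. x \<in> A"
    using AE_space
    by eventually_elim (simp add: A_def space_m initial_kernel_SUP_seq)
  then have "emeasure m (space M - A) = 0"
    using A sets_m by (subst (asm) AE_iff_measurable[where N = "space M - A"]) (auto simp: space_m)
  moreover have "absorbing M U A"
  proof -
    have "excessive M U (initial_kernel U (indicator N))"
      by (rule excessive_initial_kernel[where k = 1]) (auto simp: indicator_def)
    then show ?thesis
      unfolding absorbing_def using A A_def by blast
  qed
  moreover have "space M - (space M - A) = A"
    by (auto simp: A_def)
  ultimately have "inessential M U m (space M - A)"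
    using A by (simp add: inessential_def)
  moreover have "transient M (trivial_modification M A U)"
    unfolding transient_def
  proof (intro bexI ballI conjI)
    \<comment> \<open>On \<open>N\<close> the value \<open>1\<close> replaces the zero of
      \<open>g\<close>. Outside \<open>A\<close> the potential of the modification is at most
      \<open>g'\<close> itself, so the constant \<open>1\<close> is both positive and of finite
      potential there.\<close>
    define g' where "g' x = (if x \<in> A - N then g x else 1)" for x
    show g'[measurable]: "g' \<in> borel_measurable M"
      unfolding g'_def by measurable
    fix x assume x: "x \<in> space M"
    show "0 < g' x"
      using x by (auto simp: g'_def N_def zero_less_iff_neq_zero)
    show "initial_kernel (trivial_modification M A U) g' x < \<infinity>"
    proof (cases "x \<in> A")
      case True
      have "U a (\<lambda>y. g' y * indicator A y) x \<le> 1" if a: "a > 0" for a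
      proof -
        have "U a (\<lambda>y. g' y * indicator A y) x \<le> U a (\<lambda>y. g y + indicator N y) x"
          by (rule kernel_mono[OF kernel[OF a] x]) (auto simp: g'_def indicator_def)
        also have "\<dots> = U a g x + U a (indicator N) x"
          by (rule kernel_add[OF kernel[OF a] x]) auto
        also have "U a (indicator N) x = 0"
          using U_le_initial[OF a, of "indicator N" x] True by (simp add: A_def)
        also have "U a g x + 0 \<le> 1"
          using U_le_initial[OF a, of g x] Ug[OF x] by simp
        finally show ?thesis .
      qed
      then have "initial_kernel U (\<lambda>y. g' y * indicator A y) x \<le> 1"
        unfolding initial_kernel_def by (intro SUP_least) auto
      then show ?thesis
        using initial_kernel_trivial_modification[OF True, of g']
        by (auto intro: le_less_trans[where y = 1])
    next
      case False
      then show ?thesis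
        using initial_kernel_trivial_modification_le[OF False, of g']
        by (auto simp: g'_def intro: le_less_trans[where y = 1])
    qed
  qed
  ultimately show ?thesis
    using A by blast
qed

lemma transient_modification_imp_m_transient:
  assumes "sigma_finite_measure m" and sets_m: "sets m = sets M"
    and A[measurable]: "A \<in> sets M" and iness: "inessential M U m (space M - A)"
    and trans: "transient M (trivial_modification M A U)"
  shows "m_transient M U m"
proof -
  note [measurable_cong] = sets_m
  have space_m: "space m = space M"
    using sets_m by (rule sets_eq_imp_space_eq)
  interpret m: sigma_finite_measure m by fact
  have "space M - (space M - A) = A"
    using sets.sets_into_space[OF A] by auto
  then have abs: "absorbing M U A" and null: "emeasure m (space M - A) = 0"
    using iness by (auto simp: inessential_def)
  obtain g where g[measurable]: "g \<in> borel_measurable M"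
    and g_pos: "\<And>x. x \<in> space M \<Longrightarrow> 0 < g x"
    and g_fin: "\<And>x. x \<in> space M \<Longrightarrow> initial_kernel (trivial_modification M A U) g x < \<infinity>"
    using trans by (auto simp: transient_def)
  obtain h where h: "h \<in> borel_measurable m" "(\<integral>\<^sup>+ x. h x \<partial>m) \<noteq> \<infinity>"
      "\<And>x. x \<in> space m \<Longrightarrow> 0 < h x"
    using m.Ex_finite_integrable_function by blast
  have hM[measurable]: "h \<in> borel_measurable M"
    using h(1) sets_m measurable_cong_sets by blast
  \<comment> \<open>The minimum stays strictly positive. It inherits the finite integral from
    \<open>h\<close>, which sigma-finiteness supplies, and on \<open>A\<close> the finite potential
    from \<open>g\<close>.\<close>
  define f where "f x = min (g x) (h x)" for x
  have f[measurable]: "f \<in> borel_measurable M"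
    unfolding f_def by measurable
  show ?thesis
    unfolding m_transient_def
  proof (intro bexI conjI)
    have "(\<integral>\<^sup>+ x. f x \<partial>m) \<le> (\<integral>\<^sup>+ x. h x \<partial>m)"
      by (rule nn_integral_mono) (simp add: f_def)
    also have "\<dots> < \<infinity>"
      using h(2) by (simp add: less_top)
    finally show "(\<integral>\<^sup>+ x. f x \<partial>m) < \<infinity>" .
    have fin: "initial_kernel U f x < \<infinity>" if x: "x \<in> A" for x
    proof -
      have xM: "x \<in> space M"
        using sets.sets_into_space[OF A] x by auto
      let ?w = "\<lambda>y. f y * indicator (space M - A) y"
      have w: "?w \<in> borel_measurable M" by measurable
      have "U a f x \<le> initial_kernel U (\<lambda>y. g y * indicator A y) x" if a: "a > 0" for a
      proof -
        \<comment> \<open>On \<open>A\<close> the function \<open>f\<close> is at most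
          \<open>g\<close>; outside \<open>A\<close> it is kept as \<open>?w\<close>, whose
          potential at \<open>x\<close> vanishes because \<open>A\<close> is absorbing.\<close>
        have "U a f x \<le> U a (\<lambda>y. g y * indicator A y + ?w y) x"
          by (rule kernel_mono[OF kernel[OF a] xM]) (auto simp: f_def indicator_def)
        also have "\<dots> = U a (\<lambda>y. g y * indicator A y) x + U a ?w x"
          by (rule kernel_add[OF kernel[OF a] xM]) measurable
        also have "U a ?w x = 0"
          using U_le_initial[OF a, of ?w x] absorbing_initial_kernel_eq_0[OF abs x w]
          by (simp add: indicator_def)
        finally show ?thesis
          using U_le_initial[OF a] by (auto intro: order_trans)
      qed
      then have "initial_kernel U f x \<le> initial_kernel U (\<lambda>y. g y * indicator A y) x"
        by (subst initial_kernel_def) (auto intro: SUP_least)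
      then show ?thesis
        using g_fin[OF xM] initial_kernel_trivial_modification[OF x] by simp
    qed
    have "AE x in m. x \<in> A"
      using null A sets_m
      by (subst AE_iff_measurable[where N = "space M - A"]) (auto simp: space_m)
    then show "AE x in m. 0 < f x \<and> initial_kernel U f x < \<infinity>"
      using AE_space
    proof eventually_elim
      case (elim x)
      with fin g_pos h(3) show ?case
        by (auto simp: f_def space_m)
    qed
  qed (rule f)
qed

end

theorem proposition2p17:
  fixes M m :: "'a measure"
    and U :: "real \<Rightarrow> ('a \<Rightarrow> ennreal) \<Rightarrow> 'a \<Rightarrow> ennreal"
    and W :: "'w measure"
    and F :: "real \<Rightarrow> 'w measure"
    and X :: "real \<Rightarrow> 'w \<Rightarrow> 'a option"
    and \<theta> :: "real \<Rightarrow> 'w \<Rightarrow> 'w"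
    and P :: "'a \<Rightarrow> 'w measure"
  assumes "lusin_measurable_space M"
    and "right_process M W F X \<theta> P"
    and "resolvent_of M X P U"
    and "sigma_finite_measure m" and "sets m = sets M"
    and "sub_invariant U m"
  shows "m_transient M U m \<longleftrightarrow>
    (\<exists>A\<in>sets M. inessential M U m (space M - A) \<and> transient M (trivial_modification M A U))"
proof -
  interpret resolvent M U
    using assms(3) by unfold_locales (simp add: resolvent_of_def)
  show ?thesis
    using m_transient_imp_transient_modification[OF assms(5,6)]
      transient_modification_imp_m_transient[OF assms(4,5)] by blast
qed

end
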